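(* Let $S$ be a valuation semiring such that its unique maximal ideal $J$ is subtractive. Then $S$ is integrally closed.
   Context: All semirings are commutative, with a zero $0$ (absorbing for multiplication) and an identity $1\neq 0$. A semifield is such a semiring in which every nonzero element is multiplicatively invertible. An ideal of a semiring $S$ is a nonempty subset $I$ closed under addition and under multiplication by elements of $S$; it is subtractive if $a+b\in I$ and $a\in I$ imply $b\in I$ for all $a,b\in S$. A tomonoid $(M,+,0,\leq)$ is a commutative monoid $(M,+,0)$ with a total order $\leq$ such that $x\leq y$ implies $x+z\leq y+z$ for all $z\in M$. For a tomonoid $M$ with no greatest element, $M_\infty = M\cup\{+\infty\}$ is the tomonoid obtained by adjoining an element $+\infty$ with $m<+\infty$ for all $m\in M$ and $m+(+\infty)=(+\infty)+m=+\infty$ for all $m\in M_\infty$. An $M$-valuation on a semiring $K$ is a map $v:K\to M_\infty$, where $M$ is a tomonoid with no greatest element, such that $v(xy)=v(x)+v(y)$ and $v(x+y)\geq\min\{v(x),v(y)\}$ for all $x,y\in K$, $v(1)=0$ and $v(0)=+\infty$. A semiring $S$ is a valuation semiring if there exist a semifield $K$ containing $S$ as a subsemiring and a surjective $M$-valuation $v$ on $K$ (for some $M$) with $S=K_v=\{s\in K: v(s)\geq 0\}$. A valuation semiring is multiplicatively cancellative ($ab=ac$, $a\neq0$ imply $b=c$) and has a unique maximal ideal. For a multiplicatively cancellative semiring $S$, $F(S)$ denotes its semifield of fractions, whose elements are $a/b$ with $a\in S$, $b\in S\setminus\{0\}$, and $S$ is regarded as a subsemiring of $F(S)$. An element $u\in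 F(S)$ is integral over $S$ if there exist $n\geq 1$ and $a_1,\ldots,a_n,b_1,\ldots,b_n\in S$ such that $u^n+a_1u^{n-1}+\cdots+a_n=b_1u^{n-1}+\cdots+b_n$. The semiring $S$ is integrally closed if the set of elements of $F(S)$ that are integral over $S$ is $S$. *)

theory Defs
  imports "HOL-Algebra.Ring"
begin

section \<open>Commutative semirings, semifields and ideals\<close>

locale csemiring = semiring + comm_monoid R +
  assumes one_not_zero: "\<one> \<noteq> \<zero>"

locale semifield = csemiring +
  assumes semifield_Units: "Units R = carrier R - {\<zero>}"

definition mult_cancellative :: "('a, 'x) ring_scheme \<Rightarrow> bool" where
  "mult_cancellative S \<longleftrightarrow>
     (\<forall>a\<in>carrier S. \<forall>b\<in>carrier S. \<forall>c\<in>carrier S.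
        a \<otimes>\<^bsub>S\<^esub> b = a \<otimes>\<^bsub>S\<^esub> c \<longrightarrow> a \<noteq> \<zero>\<^bsub>S\<^esub> \<longrightarrow> b = c)"

definition semiring_ideal :: "('a, 'x) ring_scheme \<Rightarrow> 'a set \<Rightarrow> bool" where
  "semiring_ideal S I \<longleftrightarrow>
     I \<subseteq> carrier S \<and> I \<noteq> {} \<and>
     (\<forall>a\<in>I. \<forall>b\<in>I. a \<oplus>\<^bsub>S\<^esub> b \<in> I) \<and>
     (\<forall>s\<in>carrier S. \<forall>a\<in>I. s \<otimes>\<^bsub>S\<^esub> a \<in> I)"

definition subtractive :: "('a, 'x) ring_scheme \<Rightarrow> 'a set \<Rightarrow> bool" where
  "subtractive S I \<longleftrightarrow>
     (\<forall>a\<in>carrier S. \<forall>b\<in>carrier S. a \<oplus>\<^bsub>S\<^esub> b \<in> I \<longrightarrow> a \<in> I \<longrightarrow> b \<in> I)"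

definition maximal_semiring_ideal :: "('a, 'x) ring_scheme \<Rightarrow> 'a set \<Rightarrow> bool" where
  "maximal_semiring_ideal S J \<longleftrightarrow>
     semiring_ideal S J \<and> J \<noteq> carrier S \<and>
     (\<forall>I. semiring_ideal S I \<longrightarrow> J \<subseteq> I \<longrightarrow> I = J \<or> I = carrier S)"

section \<open>Totally ordered monoids\<close>

text \<open>
  The monoid operation and the neutral element of a tomonoid are written additively in the
  literature; here they are the fields \<open>mult\<close> and \<open>one\<close> inherited from the record \<open>monoid\<close>.
\<close>

record 'm tomonoid = "'m monoid" +
  tle :: "'m \<Rightarrow> 'm \<Rightarrow> bool" (infixl \<open>\<preceq>\<index>\<close> 50)

locale tomonoid = comm_monoid M for M (structure) +
  assumes tle_refl: "x \<in> carrier M \<Longrightarrow> x \<preceq> x"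
    and tle_trans: "\<lbrakk>x \<preceq> y; y \<preceq> z; x \<in> carrier M; y \<in> carrier M; z \<in> carrier M\<rbrakk> \<Longrightarrow> x \<preceq> z"
    and tle_antisym: "\<lbrakk>x \<preceq> y; y \<preceq> x; x \<in> carrier M; y \<in> carrier M\<rbrakk> \<Longrightarrow> x = y"
    and tle_total: "\<lbrakk>x \<in> carrier M; y \<in> carrier M\<rbrakk> \<Longrightarrow> x \<preceq> y \<or> y \<preceq> x"
    and tle_mono:
      "\<lbrakk>x \<preceq> y; x \<in> carrier M; y \<in> carrier M; z \<in> carrier M\<rbrakk> \<Longrightarrow> x \<otimes> z \<preceq> y \<otimes> z"

definition no_greatest :: "('m, 'x) tomonoid_scheme \<Rightarrow> bool" where
  "no_greatest M \<longleftrightarrow> \<not> (\<exists>g\<in>carrier M. \<forall>x\<in>carrier M. x \<preceq>\<^bsub>M\<^esub> g)"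

text \<open>\<open>None\<close> plays the role of the adjoined element \<open>+\<infinity>\<close>.\<close>

definition adjoin_infty :: "('m, 'x) tomonoid_scheme \<Rightarrow> 'm option tomonoid" where
  "adjoin_infty M =
     \<lparr>carrier = insert None (Some ` carrier M),
      mult = (\<lambda>x y. case (x, y) of (Some a, Some b) \<Rightarrow> Some (a \<otimes>\<^bsub>M\<^esub> b) | _ \<Rightarrow> None),
      one = Some \<one>\<^bsub>M\<^esub>,
      tle = (\<lambda>x y. case (x, y) of
                (_, None) \<Rightarrow> True
              | (None, Some b) \<Rightarrow> False
              | (Some a, Some b) \<Rightarrow> a \<preceq>\<^bsub>M\<^esub> b)\<rparr>"

definition tmin :: "('m, 'x) tomonoid_scheme \<Rightarrow> 'm \<Rightarrow> 'm \<Rightarrow> 'm" where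
  "tmin M x y = (if x \<preceq>\<^bsub>M\<^esub> y then x else y)"

lemma tomonoid_adjoin_infty:
  assumes "tomonoid M"
  shows "tomonoid (adjoin_infty M)"
proof -
  interpret tomonoid M by fact
  show ?thesis
  proof (intro tomonoid.intro comm_monoidI tomonoid_axioms.intro)
    fix x y
    assume "x \<in> carrier (adjoin_infty M)" "y \<in> carrier (adjoin_infty M)"
    then show "x \<preceq>\<^bsub>adjoin_infty M\<^esub> y \<or> y \<preceq>\<^bsub>adjoin_infty M\<^esub> x"
      and "x \<otimes>\<^bsub>adjoin_infty M\<^esub> y = y \<otimes>\<^bsub>adjoin_infty M\<^esub> x"
      using tle_total m_comm by (auto simp: adjoin_infty_def split: option.splits)
  next
    fix x y z
    assume "x \<preceq>\<^bsub>adjoin_infty M\<^esub> y" "y \<preceq>\<^bsub>adjoin_infty M\<^esub> z"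
      "x \<in> carrier (adjoin_infty M)" "y \<in> carrier (adjoin_infty M)" "z \<in> carrier (adjoin_infty M)"
    then show "x \<preceq>\<^bsub>adjoin_infty M\<^esub> z"
      using tle_trans by (auto simp: adjoin_infty_def split: option.splits)
  qed (auto simp: adjoin_infty_def m_assoc tle_refl tle_mono tle_antisym split: option.splits)
qed

section \<open>Valuations and valuation semirings\<close>

definition valuation ::
  "('k, 'x) ring_scheme \<Rightarrow> ('m, 'y) tomonoid_scheme \<Rightarrow> ('k \<Rightarrow> 'm option) \<Rightarrow> bool" where
  "valuation K M v \<longleftrightarrow>
     tomonoid M \<and> no_greatest M \<and>
     v \<in> carrier K \<rightarrow> carrier (adjoin_infty M) \<and>
     (\<forall>x\<in>carrier K. \<forall>y\<in>carrier K. v (x \<otimes>\<^bsub>K\<^esub> y) = v x \<otimes>\<^bsub>adjoin_infty M\<^esub> v y) \<and>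
     (\<forall>x\<in>carrier K. \<forall>y\<in>carrier K.
        tmin (adjoin_infty M) (v x) (v y) \<preceq>\<^bsub>adjoin_infty M\<^esub> v (x \<oplus>\<^bsub>K\<^esub> y)) \<and>
     v \<one>\<^bsub>K\<^esub> = \<one>\<^bsub>adjoin_infty M\<^esub> \<and>
     v \<zero>\<^bsub>K\<^esub> = None"

text \<open>The set \<open>K\<^sub>v\<close>; recall that \<open>\<one>\<close> of the value monoid is the additive neutral element.\<close>

definition nonneg_part ::
  "('k, 'x) ring_scheme \<Rightarrow> ('m, 'y) tomonoid_scheme \<Rightarrow> ('k \<Rightarrow> 'm option) \<Rightarrow> 'k set" where
  "nonneg_part K M v =
     {s \<in> carrier K. \<one>\<^bsub>adjoin_infty M\<^esub> \<preceq>\<^bsub>adjoin_infty M\<^esub> v s}"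

text \<open>
  \<open>ring_hom\<close> does not mention \<open>\<zero>\<close>, whose preservation is not automatic without subtraction.
\<close>

definition semiring_embedding ::
  "('a, 'x) ring_scheme \<Rightarrow> ('k, 'y) ring_scheme \<Rightarrow> ('a \<Rightarrow> 'k) \<Rightarrow> bool" where
  "semiring_embedding S K \<phi> \<longleftrightarrow>
     \<phi> \<in> ring_hom S K \<and> \<phi> \<zero>\<^bsub>S\<^esub> = \<zero>\<^bsub>K\<^esub> \<and> inj_on \<phi> (carrier S)"

text \<open>
  The semifield \<open>K\<close> and the value monoid \<open>M\<close> are existentially quantified, but HOL cannot quantify
  over the types of their elements; these are the two type arguments. Containment
  of \<open>S\<close> in \<open>K\<close> is expressed by an embedding \<open>\<phi>\<close>, so that \<open>S\<close> and \<open>K\<close> may have different element types;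
  a literal subsemiring is the case where \<open>\<phi>\<close> is the identity.
\<close>

definition valuation_semiring ::
  "'k itself \<Rightarrow> 'm itself \<Rightarrow> 'a ring \<Rightarrow> bool" where
  "valuation_semiring _ _ S \<longleftrightarrow>
     csemiring S \<and>
     (\<exists>(K :: 'k ring) (\<phi> :: 'a \<Rightarrow> 'k) (M :: 'm tomonoid) (v :: 'k \<Rightarrow> 'm option).
        semifield K \<and> semiring_embedding S K \<phi> \<and>
        valuation K M v \<and> v ` carrier K = carrier (adjoin_infty M) \<and>
        \<phi> ` carrier S = nonneg_part K M v)"

section \<open>The semifield of fractions\<close>

definition frac_pairs :: "('a, 'x) ring_scheme \<Rightarrow> ('a \<times> 'a) set" where
  "frac_pairs S = carrier S \<times> (carrier S - {\<zero>\<^bsub>S\<^esub>})"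

definition frac_rel :: "('a, 'x) ring_scheme \<Rightarrow> (('a \<times> 'a) \<times> ('a \<times> 'a)) set" where
  "frac_rel S = {((a, b), (c, d)). (a, b) \<in> frac_pairs S \<and> (c, d) \<in> frac_pairs S \<and>
                                   a \<otimes>\<^bsub>S\<^esub> d = c \<otimes>\<^bsub>S\<^esub> b}"

definition frac :: "('a, 'x) ring_scheme \<Rightarrow> 'a \<Rightarrow> 'a \<Rightarrow> ('a \<times> 'a) set" where
  "frac S a b = frac_rel S `` {(a, b)}"

text \<open>
  For multiplicatively cancellative \<open>S\<close> the unions below are over equal sets, so that
  \<open>a/b \<cdot> c/d = ac/bd\<close> and \<open>a/b + c/d = (ad + cb)/bd\<close> (lemmas \<open>frac_mult\<close> and \<open>frac_add\<close>).
\<close>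

definition frac_semifield :: "('a, 'x) ring_scheme \<Rightarrow> ('a \<times> 'a) set ring" where
  "frac_semifield S =
     \<lparr>carrier = frac_pairs S // frac_rel S,
      mult = (\<lambda>X Y. \<Union>(a, b)\<in>X. \<Union>(c, d)\<in>Y. frac S (a \<otimes>\<^bsub>S\<^esub> c) (b \<otimes>\<^bsub>S\<^esub> d)),
      one = frac S \<one>\<^bsub>S\<^esub> \<one>\<^bsub>S\<^esub>,
      zero = frac S \<zero>\<^bsub>S\<^esub> \<one>\<^bsub>S\<^esub>,
      add = (\<lambda>X Y. \<Union>(a, b)\<in>X. \<Union>(c, d)\<in>Y.
                frac S (a \<otimes>\<^bsub>S\<^esub> d \<oplus>\<^bsub>S\<^esub> c \<otimes>\<^bsub>S\<^esub> b) (b \<otimes>\<^bsub>S\<^esub> d))\<rparr>"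

definition frac_embed :: "('a, 'x) ring_scheme \<Rightarrow> 'a \<Rightarrow> ('a \<times> 'a) set" where
  "frac_embed S a = frac S a \<one>\<^bsub>S\<^esub>"

section \<open>Integral closedness\<close>

definition integral_over :: "('a, 'x) ring_scheme \<Rightarrow> ('a \<times> 'a) set \<Rightarrow> bool" where
  "integral_over S u \<longleftrightarrow>
     (let F = frac_semifield S in
       \<exists>n\<ge>1. \<exists>a b. (\<forall>i\<in>{1..n}. a i \<in> carrier S \<and> b i \<in> carrier S) \<and>
         u [^]\<^bsub>F\<^esub> (n::nat) \<oplus>\<^bsub>F\<^esub>
           (\<Oplus>\<^bsub>F\<^esub>i\<in>{1..n}. frac_embed S (a i) \<otimes>\<^bsub>F\<^esub> u [^]\<^bsub>F\<^esub> (n - i)) =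
         (\<Oplus>\<^bsub>F\<^esub>i\<in>{1..n}. frac_embed S (b i) \<otimes>\<^bsub>F\<^esub> u [^]\<^bsub>F\<^esub> (n - i)))"

text \<open>
  The notion is only meaningful for multiplicatively cancellative semirings, since otherwise
  \<open>frac_rel\<close> need not be an equivalence relation; this is made part of the definition.
\<close>

definition integrally_closed :: "('a, 'x) ring_scheme \<Rightarrow> bool" where
  "integrally_closed S \<longleftrightarrow>
     mult_cancellative S \<and>
     {u \<in> carrier (frac_semifield S). integral_over S u} = frac_embed S ` carrier S"

section \<open>The fractions form a semifield containing \<open>S\<close>\<close>

locale cancellative_csemiring = csemiring S for S (structure) +
  assumes cancellative: "mult_cancellative S"
begin

lemma cancelD:
  "\<lbrakk>a \<otimes> b = a \<otimes> c; a \<noteq> \<zero>; a \<in> carrier S; b \<in> carrier S; c \<in> carrier S\<rbrakk> \<Longrightarrow> b = c"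
  using cancellative unfolding mult_cancellative_def by blast

lemma mult_nonzero:
  assumes "a \<in> carrier S" "b \<in> carrier S" "a \<noteq> \<zero>" "b \<noteq> \<zero>"
  shows "a \<otimes> b \<noteq> \<zero>"
  using cancelD[of a b \<zero>] assms by (metis r_null zero_closed)

lemma equiv_frac_rel: "equiv (frac_pairs S) (frac_rel S)"
proof (rule equivI)
  show "frac_rel S \<subseteq> frac_pairs S \<times> frac_pairs S"
    by (auto simp: frac_rel_def)
  show "refl_on (frac_pairs S) (frac_rel S)"
    by (auto simp: refl_on_def frac_rel_def)
  show "sym (frac_rel S)"
    by (auto simp: sym_def frac_rel_def)
  show "trans (frac_rel S)"
  proof (rule transI, clarify)
    fix a b c d e f
    assume "((a, b), (c, d)) \<in> frac_rel S" "((c, d), (e, f)) \<in> frac_rel S"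
    then have *: "a \<in> carrier S" "b \<in> carrier S" "c \<in> carrier S" "d \<in> carrier S"
        "e \<in> carrier S" "f \<in> carrier S" "b \<noteq> \<zero>" "d \<noteq> \<zero>" "f \<noteq> \<zero>"
      and eq: "a \<otimes> d = c \<otimes> b" "c \<otimes> f = e \<otimes> d"
      by (auto simp: frac_rel_def frac_pairs_def)
    have "d \<otimes> (a \<otimes> f) = (a \<otimes> d) \<otimes> f" using * by (simp add: m_ac)
    also have "\<dots> = (c \<otimes> f) \<otimes> b" unfolding eq(1) using * by (simp add: m_ac)
    also have "\<dots> = d \<otimes> (e \<otimes> b)" unfolding eq(2) using * by (simp add: m_ac)
    finally have "a \<otimes> f = e \<otimes> b" by (rule cancelD) (intro * m_closed)+
    with * show "((a, b), (e, f)) \<in> frac_rel S"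
      by (simp add: frac_rel_def frac_pairs_def)
  qed
qed

lemma frac_eq_iff:
  assumes "a \<in> carrier S" "b \<in> carrier S" "b \<noteq> \<zero>" "c \<in> carrier S" "d \<in> carrier S" "d \<noteq> \<zero>"
  shows "frac S a b = frac S c d \<longleftrightarrow> a \<otimes> d = c \<otimes> b"
proof -
  have "frac S a b = frac S c d \<longleftrightarrow> ((a, b), (c, d)) \<in> frac_rel S"
    unfolding frac_def using assms
    by (intro eq_equiv_class_iff[OF equiv_frac_rel]) (auto simp: frac_pairs_def)
  then show ?thesis using assms by (auto simp: frac_rel_def frac_pairs_def)
qed

lemma carrier_frac:
  "carrier (frac_semifield S) = {frac S a b | a b. a \<in> carrier S \<and> b \<in> carrier S \<and> b \<noteq> \<zero>}"
  by (auto simp: frac_semifield_def quotient_def frac_def frac_pairs_def)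

lemma fracD:
  assumes "(c, d) \<in> frac S a b" "a \<in> carrier S" "b \<in> carrier S" "b \<noteq> \<zero>"
  shows "c \<in> carrier S" "d \<in> carrier S" "d \<noteq> \<zero>" "a \<otimes> d = c \<otimes> b"
  using assms by (auto simp: frac_def frac_rel_def frac_pairs_def)

lemma frac_self:
  "\<lbrakk>a \<in> carrier S; b \<in> carrier S; b \<noteq> \<zero>\<rbrakk> \<Longrightarrow> (a, b) \<in> frac S a b"
  by (auto simp: frac_def frac_rel_def frac_pairs_def)

lemma UN_frac:
  assumes "a \<in> carrier S" "b \<in> carrier S" "b \<noteq> \<zero>" "c \<in> carrier S" "d \<in> carrier S" "d \<noteq> \<zero>"
    and "\<And>a' b' c' d'. \<lbrakk>(a', b') \<in> frac S a b; (c', d') \<in> frac S c d\<rbrakk> \<Longrightarrow> f a' b' c' d' = f a b c d"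
  shows "(\<Union>(a, b)\<in>frac S a b. \<Union>(c, d)\<in>frac S c d. f a b c d) = f a b c d"
proof -
  have ne: "frac S a b \<noteq> {}" "frac S c d \<noteq> {}"
    using frac_self[OF assms(1-3)] frac_self[OF assms(4-6)] by auto
  have inner: "(\<Union>(c, d)\<in>frac S c d. f a' b' c d) = f a b c d" if "(a', b') \<in> frac S a b" for a' b'
    by (rule SUP_eq_const[OF ne(2)]) (clarify, rule assms(7)[OF that])
  show ?thesis
    by (rule SUP_eq_const[OF ne(1)]) (clarify, rule inner)
qed

lemma frac_mult:
  assumes *: "a \<in> carrier S" "b \<in> carrier S" "b \<noteq> \<zero>" "c \<in> carrier S" "d \<in> carrier S" "d \<noteq> \<zero>"
  shows "frac S a b \<otimes>\<^bsub>frac_semifield S\<^esub> frac S c d = frac S (a \<otimes> c) (b \<otimes> d)"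
proof -
  have "(\<Union>(a, b)\<in>frac S a b. \<Union>(c, d)\<in>frac S c d. frac S (a \<otimes> c) (b \<otimes> d)) =
      frac S (a \<otimes> c) (b \<otimes> d)"
  proof (rule UN_frac[OF *, where f = "\<lambda>a b c d. frac S (a \<otimes> c) (b \<otimes> d)"])
    fix a' b' c' d' assume "(a', b') \<in> frac S a b" "(c', d') \<in> frac S c d"
    note 1 = fracD[OF this(1) *(1-3)] and 2 = fracD[OF this(2) *(4-6)]
    have "(a \<otimes> c) \<otimes> (b' \<otimes> d') = (a \<otimes> b') \<otimes> (c \<otimes> d')" using * 1(1-3) 2(1-3) by (simp add: m_ac)
    also have "\<dots> = (a' \<otimes> c') \<otimes> (b \<otimes> d)" unfolding 1(4) 2(4) using * 1(1-3) 2(1-3) by (simp add: m_ac)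
    finally have "(a \<otimes> c) \<otimes> (b' \<otimes> d') = (a' \<otimes> c') \<otimes> (b \<otimes> d)" .
    from this[symmetric] show "frac S (a' \<otimes> c') (b' \<otimes> d') = frac S (a \<otimes> c) (b \<otimes> d)"
      by (rule iffD2[OF frac_eq_iff, rotated -1])
         (intro m_closed add.m_closed mult_nonzero * 1(1-3) 2(1-3))+
  qed
  then show ?thesis by (simp add: frac_semifield_def)
qed

lemma frac_add:
  assumes *: "a \<in> carrier S" "b \<in> carrier S" "b \<noteq> \<zero>" "c \<in> carrier S" "d \<in> carrier S" "d \<noteq> \<zero>"
  shows "frac S a b \<oplus>\<^bsub>frac_semifield S\<^esub> frac S c d = frac S (a \<otimes> d \<oplus> c \<otimes> b) (b \<otimes> d)"
proof -
  have "(\<Union>(a, b)\<in>frac S a b. \<Union>(c, d)\<in>frac S c d. frac S (a \<otimes> d \<oplus> c \<otimes> b) (b \<otimes> d)) =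
      frac S (a \<otimes> d \<oplus> c \<otimes> b) (b \<otimes> d)"
  proof (rule UN_frac[OF *, where f = "\<lambda>a b c d. frac S (a \<otimes> d \<oplus> c \<otimes> b) (b \<otimes> d)"])
    fix a' b' c' d' assume "(a', b') \<in> frac S a b" "(c', d') \<in> frac S c d"
    note 1 = fracD[OF this(1) *(1-3)] and 2 = fracD[OF this(2) *(4-6)]
    have "(a \<otimes> d \<oplus> c \<otimes> b) \<otimes> (b' \<otimes> d') = (a \<otimes> b') \<otimes> (d \<otimes> d') \<oplus> (c \<otimes> d') \<otimes> (b \<otimes> b')"
      using * 1(1-3) 2(1-3) by (simp add: m_ac l_distr r_distr)
    also have "\<dots> = (a' \<otimes> d' \<oplus> c' \<otimes> b') \<otimes> (b \<otimes> d)"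
      unfolding 1(4) 2(4) using * 1(1-3) 2(1-3) by (simp add: m_ac l_distr r_distr)
    finally have "(a \<otimes> d \<oplus> c \<otimes> b) \<otimes> (b' \<otimes> d') = (a' \<otimes> d' \<oplus> c' \<otimes> b') \<otimes> (b \<otimes> d)" .
    from this[symmetric] show "frac S (a' \<otimes> d' \<oplus> c' \<otimes> b') (b' \<otimes> d') = frac S (a \<otimes> d \<oplus> c \<otimes> b) (b \<otimes> d)"
      by (rule iffD2[OF frac_eq_iff, rotated -1])
         (intro m_closed add.m_closed mult_nonzero * 1(1-3) 2(1-3))+
  qed
  then show ?thesis by (simp add: frac_semifield_def)
qed

lemma frac_one: "\<one>\<^bsub>frac_semifield S\<^esub> = frac S \<one> \<one>"
  and frac_zero: "\<zero>\<^bsub>frac_semifield S\<^esub> = frac S \<zero> \<one>"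
  by (simp_all add: frac_semifield_def)

lemma frac_carrierE:
  assumes "x \<in> carrier (frac_semifield S)"
  obtains a b where "a \<in> carrier S" "b \<in> carrier S" "b \<noteq> \<zero>" "x = frac S a b"
  using assms unfolding carrier_frac by blast

lemma frac_closed:
  "\<lbrakk>a \<in> carrier S; b \<in> carrier S; b \<noteq> \<zero>\<rbrakk> \<Longrightarrow> frac S a b \<in> carrier (frac_semifield S)"
  unfolding carrier_frac by blast

lemma semifield_frac: "semifield (frac_semifield S)"
proof -
  note [simp] = frac_mult frac_add frac_one frac_zero frac_eq_iff mult_nonzero one_not_zero
    frac_closed
  let ?F = "frac_semifield S"
  have "abelian_monoid ?F"
  proof (rule abelian_monoidI)
    fix x y assume "x \<in> carrier ?F" "y \<in> carrier ?F"
    then show "x \<oplus>\<^bsub>?F\<^esub> y \<in> carrier ?F" "x \<oplus>\<^bsub>?F\<^esub> y = y \<oplus>\<^bsub>?F\<^esub> x"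
      by (auto elim!: frac_carrierE simp: m_ac add.m_ac)
  next
    fix x y z assume "x \<in> carrier ?F" "y \<in> carrier ?F" "z \<in> carrier ?F"
    then show "(x \<oplus>\<^bsub>?F\<^esub> y) \<oplus>\<^bsub>?F\<^esub> z = x \<oplus>\<^bsub>?F\<^esub> (y \<oplus>\<^bsub>?F\<^esub> z)"
      by (auto elim!: frac_carrierE simp: l_distr r_distr m_ac add.m_ac)
  qed (auto elim!: frac_carrierE)
  moreover have "comm_monoid ?F"
  proof (rule comm_monoidI)
    fix x y assume "x \<in> carrier ?F" "y \<in> carrier ?F"
    then show "x \<otimes>\<^bsub>?F\<^esub> y \<in> carrier ?F" "x \<otimes>\<^bsub>?F\<^esub> y = y \<otimes>\<^bsub>?F\<^esub> x"
      by (auto elim!: frac_carrierE simp: m_ac)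
  next
    fix x y z assume "x \<in> carrier ?F" "y \<in> carrier ?F" "z \<in> carrier ?F"
    then show "(x \<otimes>\<^bsub>?F\<^esub> y) \<otimes>\<^bsub>?F\<^esub> z = x \<otimes>\<^bsub>?F\<^esub> (y \<otimes>\<^bsub>?F\<^esub> z)"
      by (auto elim!: frac_carrierE simp: m_ac)
  qed (auto elim!: frac_carrierE)
  moreover have "semiring_axioms ?F"
  proof
    fix x y z assume "x \<in> carrier ?F" "y \<in> carrier ?F" "z \<in> carrier ?F"
    then show "(x \<oplus>\<^bsub>?F\<^esub> y) \<otimes>\<^bsub>?F\<^esub> z = x \<otimes>\<^bsub>?F\<^esub> z \<oplus>\<^bsub>?F\<^esub> y \<otimes>\<^bsub>?F\<^esub> z"
      and "z \<otimes>\<^bsub>?F\<^esub> (x \<oplus>\<^bsub>?F\<^esub> y) = z \<otimes>\<^bsub>?F\<^esub> x \<oplus>\<^bsub>?F\<^esub> z \<otimes>\<^bsub>?F\<^esub> y"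
      by (elim frac_carrierE; simp add: l_distr r_distr m_ac add.m_ac)+
  qed (elim frac_carrierE; simp)+
  moreover have "csemiring_axioms ?F"
    by unfold_locales simp
  moreover have "Units ?F = carrier ?F - {\<zero>\<^bsub>?F\<^esub>}"
  proof (intro equalityI subsetI)
    fix x assume "x \<in> Units ?F"
    then show "x \<in> carrier ?F - {\<zero>\<^bsub>?F\<^esub>}"
      by (auto simp: Units_def elim!: frac_carrierE)
  next
    fix x assume "x \<in> carrier ?F - {\<zero>\<^bsub>?F\<^esub>}"
    then have x: "x \<in> carrier ?F" "x \<noteq> \<zero>\<^bsub>?F\<^esub>" by simp_all
    obtain a b where *: "a \<in> carrier S" "b \<in> carrier S" "b \<noteq> \<zero>" "x = frac S a b"
      using x(1) by (rule frac_carrierE)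
    with x(2) have "a \<noteq> \<zero>" by auto
    with * have "frac S b a \<in> carrier ?F" "x \<in> carrier ?F"
      "frac S b a \<otimes>\<^bsub>?F\<^esub> x = \<one>\<^bsub>?F\<^esub>" "x \<otimes>\<^bsub>?F\<^esub> frac S b a = \<one>\<^bsub>?F\<^esub>"
      by (simp_all add: m_comm)
    then show "x \<in> Units ?F" unfolding Units_def by blast
  qed
  ultimately show ?thesis
    by (intro semifield.intro csemiring.intro semiring.intro semifield_axioms.intro
        comm_monoid.axioms(1))
qed

lemma frac_embedding: "semiring_embedding S (frac_semifield S) (frac_embed S)"
  unfolding semiring_embedding_def ring_hom_def frac_embed_def inj_on_def
  using one_not_zero
  by (auto simp: carrier_frac frac_mult frac_add frac_one frac_zero frac_eq_iff)

end

end

theory Submission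
  imports Defs "HOL-Algebra.Divisibility"
begin

text \<open>
  The valuation enters only through one consequence: any two elements of a valuation semiring are
  comparable for divisibility, because the quotient \<open>k\<close> of two nonzero elements has
  \<open>v(k) \<ge> 0\<close> or \<open>v(1/k) \<ge> 0\<close> (\<open>valuation_semiring_divides_total\<close>). The remainder of the argument
  takes place in a cancellative semiring with total divisibility. There the nonunits are closed
  under addition, since \<open>x + t x = (1 + t) x\<close>, so they form the unique maximal ideal \<open>J\<close>.

  A fraction \<open>u\<close> outside \<open>S\<close> is then the inverse \<open>1/t\<close> of a nonunit \<open>t\<close>. Multiplying an integral
  equation of degree \<open>n\<close> for \<open>u\<close> by \<open>t\<^sup>n\<close> gives
  \<open>1 + (a\<^sub>1 t + \<dots> + a\<^sub>n t\<^sup>n) = b\<^sub>1 t + \<dots> + b\<^sub>n t\<^sup>n\<close> in \<open>S\<close>, where both sums lie in \<open>J\<close>.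
  In a ring one would subtract and obtain \<open>1 \<in> J\<close>; here this is exactly what subtractivity of \<open>J\<close>
  provides, and it contradicts that \<open>J\<close> is proper.
\<close>

section \<open>Ideals and units\<close>

lemma (in csemiring) zero_in_semiring_ideal:
  assumes "semiring_ideal R I"
  shows "\<zero> \<in> I"
proof -
  obtain a where "a \<in> I" "a \<in> carrier R"
    using assms unfolding semiring_ideal_def by blast
  then have "\<zero> \<otimes> a \<in> I" using assms unfolding semiring_ideal_def by blast
  with \<open>a \<in> carrier R\<close> show ?thesis by simp
qed

lemma (in csemiring) proper_semiring_ideal_one:
  assumes "semiring_ideal R I" "I \<noteq> carrier R"
  shows "\<one> \<notin> I"
proof
  assume "\<one> \<in> I"
  then have "s \<in> I" if "s \<in> carrier R" for s
    using assms(1) that unfolding semiring_ideal_def by (metis r_one)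
  with assms show False unfolding semiring_ideal_def by blast
qed

lemma (in csemiring) proper_semiring_ideal_nonunits:
  assumes "semiring_ideal R I" "I \<noteq> carrier R"
  shows "I \<subseteq> carrier R - Units R"
proof
  fix x assume x: "x \<in> I"
  then have xc: "x \<in> carrier R" using assms unfolding semiring_ideal_def by blast
  moreover have "x \<notin> Units R"
  proof
    assume "x \<in> Units R"
    then obtain y where "y \<in> carrier R" "y \<otimes> x = \<one>" unfolding Units_def by blast
    with x assms(1) have "\<one> \<in> I" unfolding semiring_ideal_def by metis
    then show False using proper_semiring_ideal_one[OF assms] by blast
  qed
  ultimately show "x \<in> carrier R - Units R" by blast
qed

text \<open>
  If \<open>y = t x\<close> then \<open>x + y = (1 + t) x\<close>, so a unit \<open>x + y\<close> would have the factor \<open>x\<close> and force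
  \<open>x\<close> to be a unit: comparability for divisibility makes the nonunits an ideal.
\<close>

lemma (in csemiring) nonunits_ideal:
  assumes total: "\<And>x y. x \<in> carrier R \<Longrightarrow> y \<in> carrier R \<Longrightarrow>
      (\<exists>s\<in>carrier R. x = s \<otimes> y) \<or> (\<exists>t\<in>carrier R. y = t \<otimes> x)"
  shows "semiring_ideal R (carrier R - Units R)"
proof -
  have mult: "s \<otimes> x \<in> carrier R - Units R"
    if "s \<in> carrier R" "x \<in> carrier R - Units R" for s x
    using that unit_factor[of x s] by (auto simp: m_comm)
  have multiple: "x \<oplus> t \<otimes> x \<in> carrier R - Units R"
    if "t \<in> carrier R" "x \<in> carrier R - Units R" for t x
    using mult[of "\<one> \<oplus> t" x] that by (simp add: l_distr)
  have add: "x \<oplus> y \<in> carrier R - Units R"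
    if "x \<in> carrier R - Units R" "y \<in> carrier R - Units R" for x y
  proof -
    have xy: "x \<in> carrier R" "y \<in> carrier R" using that by blast+
    from total[OF xy] show ?thesis
    proof (elim disjE bexE)
      fix s assume "s \<in> carrier R" "x = s \<otimes> y"
      then show ?thesis using multiple[of s y] that(2) xy by (simp add: add.m_comm)
    next
      fix t assume "t \<in> carrier R" "y = t \<otimes> x"
      then show ?thesis using multiple[of t x] that(1) by simp
    qed
  qed
  have "\<zero> \<in> carrier R - Units R"
    using one_not_zero by (auto simp: Units_def)
  with mult add show ?thesis unfolding semiring_ideal_def by blast
qed

lemma (in csemiring) maximal_semiring_ideal_nonunits:
  assumes total: "\<And>x y. x \<in> carrier R \<Longrightarrow> y \<in> carrier R \<Longrightarrow>
      (\<exists>s\<in>carrier R. x = s \<otimes> y) \<or> (\<exists>t\<in>carrier R. y = t \<otimes> x)"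
    and J: "maximal_semiring_ideal R J"
  shows "J = carrier R - Units R"
proof -
  have "J \<subseteq> carrier R - Units R"
    using J proper_semiring_ideal_nonunits unfolding maximal_semiring_ideal_def by blast
  moreover have "carrier R - Units R \<noteq> carrier R" by blast
  ultimately show ?thesis
    using J nonunits_ideal[OF total] unfolding maximal_semiring_ideal_def by blast
qed

section \<open>Integral fractions\<close>

context cancellative_csemiring
begin

interpretation F: semifield "frac_semifield S"
  by (rule semifield_frac)

lemma frac_embed_closed: "s \<in> carrier S \<Longrightarrow> frac_embed S s \<in> carrier (frac_semifield S)"
  and frac_embed_mult: "\<lbrakk>s \<in> carrier S; t \<in> carrier S\<rbrakk> \<Longrightarrow>
    frac_embed S (s \<otimes> t) = frac_embed S s \<otimes>\<^bsub>frac_semifield S\<^esub> frac_embed S t"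
  and frac_embed_add: "\<lbrakk>s \<in> carrier S; t \<in> carrier S\<rbrakk> \<Longrightarrow>
    frac_embed S (s \<oplus> t) = frac_embed S s \<oplus>\<^bsub>frac_semifield S\<^esub> frac_embed S t"
  and frac_embed_one: "frac_embed S \<one> = \<one>\<^bsub>frac_semifield S\<^esub>"
  and frac_embed_zero: "frac_embed S \<zero> = \<zero>\<^bsub>frac_semifield S\<^esub>"
  and frac_embed_inj: "inj_on (frac_embed S) (carrier S)"
  using frac_embedding unfolding semiring_embedding_def ring_hom_def by auto

lemma frac_embed_pow:
  "s \<in> carrier S \<Longrightarrow> frac_embed S (s [^] (n::nat)) = frac_embed S s [^]\<^bsub>frac_semifield S\<^esub> n"
  by (induction n) (simp_all add: frac_embed_one frac_embed_mult)

text \<open>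
  As \<open>t u = 1\<close>, multiplication by \<open>t\<^sup>n\<close> turns the term \<open>c\<^sub>i u\<^sup>n\<^sup>-\<^sup>i\<close> into \<open>c\<^sub>i t\<^sup>i\<close>. This clears
  denominators and, because the sum starts at \<open>i = 1\<close>, leaves at least one factor \<open>t\<close> in each term.
\<close>

lemma lower_terms_in_ideal:
  fixes n :: nat
  assumes I: "semiring_ideal S I" and t: "t \<in> I"
    and u: "u \<in> carrier (frac_semifield S)"
    and tu: "frac_embed S t \<otimes>\<^bsub>frac_semifield S\<^esub> u = \<one>\<^bsub>frac_semifield S\<^esub>"
    and c: "\<forall>i\<in>{1..n}. c i \<in> carrier S"
  shows "frac_embed S t [^]\<^bsub>frac_semifield S\<^esub> n \<otimes>\<^bsub>frac_semifield S\<^esub>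
      (\<Oplus>\<^bsub>frac_semifield S\<^esub>i\<in>{1..n}. frac_embed S (c i) \<otimes>\<^bsub>frac_semifield S\<^esub>
        u [^]\<^bsub>frac_semifield S\<^esub> (n - i)) \<in> frac_embed S ` I"
proof -
  let ?F = "frac_semifield S" and ?e = "frac_embed S"
  have IS: "I \<subseteq> carrier S" and Iadd: "\<And>a b. a \<in> I \<Longrightarrow> b \<in> I \<Longrightarrow> a \<oplus> b \<in> I"
    and Imult: "\<And>s a. s \<in> carrier S \<Longrightarrow> a \<in> I \<Longrightarrow> s \<otimes> a \<in> I"
    using I unfolding semiring_ideal_def by blast+
  have tS: "t \<in> carrier S" using t IS by blast
  have et: "?e t \<in> carrier ?F" by (rule frac_embed_closed[OF tS])
  have tu_pow: "?e t [^]\<^bsub>?F\<^esub> k \<otimes>\<^bsub>?F\<^esub> u [^]\<^bsub>?F\<^esub> k = \<one>\<^bsub>?F\<^esub>" for k :: nat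
    using F.pow_mult_distrib[OF F.m_comm[OF et u] et u, of k] by (simp add: tu)
  have pow_in: "t [^] i \<in> I" if "1 \<le> i" for i :: nat
    using that Imult[OF _ t] tS by (cases i) simp_all
  have term_in: "?e t [^]\<^bsub>?F\<^esub> n \<otimes>\<^bsub>?F\<^esub> (?e (c i) \<otimes>\<^bsub>?F\<^esub> u [^]\<^bsub>?F\<^esub> (n - i)) \<in> ?e ` I"
    if i: "i \<in> {1..n}" for i
  proof -
    have ci: "c i \<in> carrier S" using c i by blast
    have split: "?e t [^]\<^bsub>?F\<^esub> n = ?e t [^]\<^bsub>?F\<^esub> i \<otimes>\<^bsub>?F\<^esub> ?e t [^]\<^bsub>?F\<^esub> (n - i)"
      using F.nat_pow_mult[OF et, of i "n - i"] i by simp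
    have "?e t [^]\<^bsub>?F\<^esub> n \<otimes>\<^bsub>?F\<^esub> (?e (c i) \<otimes>\<^bsub>?F\<^esub> u [^]\<^bsub>?F\<^esub> (n - i)) =
        (?e (c i) \<otimes>\<^bsub>?F\<^esub> ?e t [^]\<^bsub>?F\<^esub> i) \<otimes>\<^bsub>?F\<^esub> (?e t [^]\<^bsub>?F\<^esub> (n - i) \<otimes>\<^bsub>?F\<^esub> u [^]\<^bsub>?F\<^esub> (n - i))"
      unfolding split using et u frac_embed_closed[OF ci] by (simp add: F.m_ac)
    also have "\<dots> = ?e (c i \<otimes> t [^] i)"
      using et frac_embed_closed[OF ci] tS ci by (simp add: tu_pow frac_embed_mult frac_embed_pow)
    finally show ?thesis using Imult[OF ci pow_in] i by auto
  qed
  have sum_in: "finsum ?F f A \<in> ?e ` I" if "finite A" "\<And>i. i \<in> A \<Longrightarrow> f i \<in> ?e ` I"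
    for A :: "nat set" and f
    using that
  proof (induction A rule: finite_induct)
    case empty
    then show ?case using zero_in_semiring_ideal[OF I] by (auto simp flip: frac_embed_zero)
  next
    case (insert j A)
    have "?e ` I \<subseteq> carrier ?F" using IS frac_embed_closed by blast
    then have "finsum ?F f (insert j A) = f j \<oplus>\<^bsub>?F\<^esub> finsum ?F f A"
      using insert by (intro F.finsum_insert) auto
    moreover obtain x y where "x \<in> I" "y \<in> I" "f j = ?e x" "finsum ?F f A = ?e y"
      using insert by blast
    ultimately have "finsum ?F f (insert j A) = ?e (x \<oplus> y)"
      using IS by (simp add: frac_embed_add subset_iff)
    with Iadd[OF \<open>x \<in> I\<close> \<open>y \<in> I\<close>] show ?case by blast
  qed
  have "(\<Oplus>\<^bsub>?F\<^esub>i\<in>{1..n}. ?e t [^]\<^bsub>?F\<^esub> n \<otimes>\<^bsub>?F\<^esub>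
      (?e (c i) \<otimes>\<^bsub>?F\<^esub> u [^]\<^bsub>?F\<^esub> (n - i))) \<in> ?e ` I"
    by (intro sum_in term_in) simp_all
  then show ?thesis
    using c et u frac_embed_closed by (subst F.finsum_rdistr) auto
qed

text \<open>
  After multiplication by \<open>t\<^sup>n\<close> the leading term of an integral equation becomes \<open>1\<close> and both sums
  become elements \<open>x\<close>, \<open>y\<close> of the ideal with \<open>x + 1 = y\<close>. Subtractivity is what replaces the
  subtraction \<open>1 = y - x\<close>.
\<close>

lemma inverse_not_integral:
  assumes I: "semiring_ideal S I" "I \<noteq> carrier S" "subtractive S I" and t: "t \<in> I"
    and u: "u \<in> carrier (frac_semifield S)"
    and tu: "frac_embed S t \<otimes>\<^bsub>frac_semifield S\<^esub> u = \<one>\<^bsub>frac_semifield S\<^esub>"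
  shows "\<not> integral_over S u"
proof
  let ?F = "frac_semifield S" and ?e = "frac_embed S"
  let ?sum = "\<lambda>(n::nat) c. \<Oplus>\<^bsub>?F\<^esub>i\<in>{1..n}. ?e (c i) \<otimes>\<^bsub>?F\<^esub> u [^]\<^bsub>?F\<^esub> (n - i)"
  have IS: "I \<subseteq> carrier S" using I(1) unfolding semiring_ideal_def by blast
  have et: "?e t \<in> carrier ?F" using t IS by (blast intro: frac_embed_closed)
  assume "integral_over S u"
  then obtain n :: nat and a b where
    ab: "\<forall>i\<in>{1..n}. a i \<in> carrier S" "\<forall>i\<in>{1..n}. b i \<in> carrier S"
    and eq: "u [^]\<^bsub>?F\<^esub> n \<oplus>\<^bsub>?F\<^esub> ?sum n a = ?sum n b"
    unfolding integral_over_def Let_def by blast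
  obtain x where x: "x \<in> I" "?e t [^]\<^bsub>?F\<^esub> n \<otimes>\<^bsub>?F\<^esub> ?sum n a = ?e x"
    using lower_terms_in_ideal[OF I(1) t u tu ab(1)] by blast
  obtain y where y: "y \<in> I" "?e t [^]\<^bsub>?F\<^esub> n \<otimes>\<^bsub>?F\<^esub> ?sum n b = ?e y"
    using lower_terms_in_ideal[OF I(1) t u tu ab(2)] by blast
  have sum_closed: "?sum n a \<in> carrier ?F"
    using ab u frac_embed_closed by (intro F.finsum_closed) auto
  have xyS: "x \<in> carrier S" "y \<in> carrier S" using x y IS by blast+
  have "?e (x \<oplus> \<one>) = \<one>\<^bsub>?F\<^esub> \<oplus>\<^bsub>?F\<^esub> ?e x"
    using xyS by (simp add: frac_embed_add frac_embed_one frac_embed_closed F.add.m_comm)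
  also have "\<dots> = ?e t [^]\<^bsub>?F\<^esub> n \<otimes>\<^bsub>?F\<^esub> (u [^]\<^bsub>?F\<^esub> n \<oplus>\<^bsub>?F\<^esub> ?sum n a)"
    using F.pow_mult_distrib[OF F.m_comm[OF et u] et u, of n] et u sum_closed
    by (simp add: F.r_distr tu x(2) del: One_nat_def)
  also have "\<dots> = ?e y" using eq y(2) by simp
  finally have "x \<oplus> \<one> = y" using frac_embed_inj xyS by (simp add: inj_on_eq_iff)
  then have "\<one> \<in> I" using I(3) x(1) y(1) xyS unfolding subtractive_def by blast
  then show False using proper_semiring_ideal_one[OF I(1,2)] by blast
qed

lemma frac_embed_integral:
  assumes s: "s \<in> carrier S"
  shows "integral_over S (frac_embed S s)"
proof -
  \<comment> \<open>The equation \<open>u + 0 = s\<close> of degree one.\<close>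
  have "\<exists>a b. (\<forall>i\<in>{1..1::nat}. a i \<in> carrier S \<and> b i \<in> carrier S) \<and>
      frac_embed S s [^]\<^bsub>frac_semifield S\<^esub> (1::nat) \<oplus>\<^bsub>frac_semifield S\<^esub>
        (\<Oplus>\<^bsub>frac_semifield S\<^esub>i\<in>{1..1::nat}. frac_embed S (a i) \<otimes>\<^bsub>frac_semifield S\<^esub>
          frac_embed S s [^]\<^bsub>frac_semifield S\<^esub> (1 - i)) =
      (\<Oplus>\<^bsub>frac_semifield S\<^esub>i\<in>{1..1::nat}. frac_embed S (b i) \<otimes>\<^bsub>frac_semifield S\<^esub>
          frac_embed S s [^]\<^bsub>frac_semifield S\<^esub> (1 - i))"
    by (rule exI[of _ "\<lambda>_. \<zero>"], rule exI[of _ "\<lambda>_. s"])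
      (use s frac_embed_closed[OF s] in \<open>simp add: frac_embed_zero\<close>)
  then show ?thesis
    unfolding integral_over_def Let_def by (intro exI[of _ "1::nat"] conjI order.refl)
qed

text \<open>
  For a fraction \<open>x/y\<close>, either \<open>y\<close> divides \<open>x\<close> and the fraction lies in \<open>S\<close>, or \<open>y = t x\<close> and the
  fraction is \<open>1/t\<close>. In the second case it lies in \<open>S\<close> if \<open>t\<close> is a unit; otherwise \<open>t\<close> lies in the
  maximal ideal and the fraction is not integral.
\<close>

lemma integrally_closed_if_divides_total:
  assumes total: "\<And>x y. x \<in> carrier S \<Longrightarrow> y \<in> carrier S \<Longrightarrow>
      (\<exists>s\<in>carrier S. x = s \<otimes> y) \<or> (\<exists>t\<in>carrier S. y = t \<otimes> x)"
    and J: "maximal_semiring_ideal S J" "subtractive S J"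
  shows "integrally_closed S"
proof -
  have J_nonunits: "J = carrier S - Units S"
    by (rule maximal_semiring_ideal_nonunits[OF total J(1)])
  have "u \<in> frac_embed S ` carrier S"
    if u: "u \<in> carrier (frac_semifield S)" and int: "integral_over S u" for u
  proof -
    obtain x y where xy: "x \<in> carrier S" "y \<in> carrier S" "y \<noteq> \<zero>" and u_eq: "u = frac S x y"
      using u by (rule frac_carrierE)
    have multiple: ?thesis if "s \<in> carrier S" "x = s \<otimes> y" for s
    proof -
      have "u = frac_embed S s"
        unfolding u_eq frac_embed_def using xy that one_not_zero by (simp add: frac_eq_iff)
      with that show ?thesis by blast
    qed
    consider (left) s where "s \<in> carrier S" "x = s \<otimes> y"
      | (right) t where "t \<in> carrier S" "y = t \<otimes> x"
      using total xy by blast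
    then show ?thesis
    proof cases
      case left
      then show ?thesis by (rule multiple)
    next
      case right
      show ?thesis
      proof (cases "t \<in> Units S")
        case True
        then obtain s where s: "s \<in> carrier S" "s \<otimes> t = \<one>" unfolding Units_def by blast
        then have "x = s \<otimes> y" using right xy by (simp flip: m_assoc)
        with s(1) show ?thesis by (rule multiple)
      next
        case False
        then have "t \<in> J" using right J_nonunits by blast
        moreover have "frac_embed S t \<otimes>\<^bsub>frac_semifield S\<^esub> u = \<one>\<^bsub>frac_semifield S\<^esub>"
          unfolding u_eq frac_embed_def frac_one
          using xy right one_not_zero by (simp add: frac_mult frac_eq_iff)
        ultimately have "\<not> integral_over S u"
          using J unfolding maximal_semiring_ideal_def
          by (intro inverse_not_integral[OF _ _ J(2) _ u]) simp_all
        with int show ?thesis by blast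
      qed
    qed
  qed
  then show ?thesis
    unfolding integrally_closed_def
    using cancellative by (auto intro: frac_embed_closed frac_embed_integral)
qed

end

section \<open>Valuation semirings\<close>

lemma (in semifield) nonzero_inverse:
  assumes "x \<in> carrier R" "x \<noteq> \<zero>"
  obtains y where "y \<in> carrier R" "x \<otimes> y = \<one>"
proof -
  have "x \<in> Units R" using assms by (simp add: semifield_Units)
  then show thesis using that unfolding Units_def by blast
qed

lemma (in semifield) mult_cancellative: "mult_cancellative R"
  unfolding mult_cancellative_def
proof (intro ballI impI)
  fix a b c assume *: "a \<in> carrier R" "b \<in> carrier R" "c \<in> carrier R" "a \<otimes> b = a \<otimes> c" "a \<noteq> \<zero>"
  then show "b = c" using Units_l_cancel[of a b c] by (simp add: semifield_Units)
qed

lemma semiring_embedding_mult_cancellative: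
  assumes S: "csemiring S" and K: "mult_cancellative K" and \<phi>: "semiring_embedding S K \<phi>"
  shows "mult_cancellative S"
  unfolding mult_cancellative_def
proof (intro ballI impI)
  interpret csemiring S by fact
  fix a b c
  assume *: "a \<in> carrier S" "b \<in> carrier S" "c \<in> carrier S"
    "a \<otimes>\<^bsub>S\<^esub> b = a \<otimes>\<^bsub>S\<^esub> c" "a \<noteq> \<zero>\<^bsub>S\<^esub>"
  have hom: "\<phi> \<in> ring_hom S K" and inj: "inj_on \<phi> (carrier S)"
    and zero: "\<phi> \<zero>\<^bsub>S\<^esub> = \<zero>\<^bsub>K\<^esub>"
    using \<phi> unfolding semiring_embedding_def by blast+
  have "\<phi> a \<noteq> \<zero>\<^bsub>K\<^esub>" using inj * zero by (metis inj_on_eq_iff zero_closed)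
  moreover have "\<phi> a \<otimes>\<^bsub>K\<^esub> \<phi> b = \<phi> a \<otimes>\<^bsub>K\<^esub> \<phi> c"
    using ring_hom_mult[OF hom] * by metis
  ultimately have "\<phi> b = \<phi> c"
    using K ring_hom_closed[OF hom] * unfolding mult_cancellative_def by blast
  then show "b = c" using inj * by (simp add: inj_on_eq_iff)
qed

text \<open>
  If \<open>x y = 1\<close> and \<open>v x \<le> 0\<close>, then adding \<open>v y\<close> gives \<open>0 = v x + v y \<le> v y\<close>.
\<close>

lemma valuation_inverse_nonneg:
  assumes v: "valuation K M v"
    and xy: "x \<in> carrier K" "y \<in> carrier K" "x \<otimes>\<^bsub>K\<^esub> y = \<one>\<^bsub>K\<^esub>"
  shows "x \<in> nonneg_part K M v \<or> y \<in> nonneg_part K M v"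
proof -
  let ?N = "adjoin_infty M"
  interpret N: tomonoid ?N
    using v tomonoid_adjoin_infty unfolding valuation_def by blast
  have vc: "v x \<in> carrier ?N" "v y \<in> carrier ?N"
    using v xy unfolding valuation_def by (blast dest: funcset_mem)+
  have "v (x \<otimes>\<^bsub>K\<^esub> y) = v x \<otimes>\<^bsub>?N\<^esub> v y" "v \<one>\<^bsub>K\<^esub> = \<one>\<^bsub>?N\<^esub>"
    using v xy unfolding valuation_def by blast+
  with xy have sum: "v x \<otimes>\<^bsub>?N\<^esub> v y = \<one>\<^bsub>?N\<^esub>" by simp
  from N.tle_total[OF N.one_closed vc(1)] show ?thesis
  proof
    assume "\<one>\<^bsub>?N\<^esub> \<preceq>\<^bsub>?N\<^esub> v x"
    then show ?thesis using xy unfolding nonneg_part_def by blast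
  next
    assume "v x \<preceq>\<^bsub>?N\<^esub> \<one>\<^bsub>?N\<^esub>"
    then have "v x \<otimes>\<^bsub>?N\<^esub> v y \<preceq>\<^bsub>?N\<^esub> \<one>\<^bsub>?N\<^esub> \<otimes>\<^bsub>?N\<^esub> v y"
      using vc by (intro N.tle_mono) auto
    then show ?thesis using xy vc sum unfolding nonneg_part_def by simp
  qed
qed

text \<open>
  The quotients \<open>k = x/y\<close> and \<open>l = y/x\<close> in \<open>K\<close> are mutually inverse, so one of them has nonnegative
  value and therefore comes from \<open>S\<close>; injectivity of \<open>\<phi>\<close> brings the equation back to \<open>S\<close>.
\<close>

lemma valuation_semiring_divides_total:
  assumes S: "csemiring S" and K: "semifield K" and \<phi>: "semiring_embedding S K \<phi>"
    and v: "valuation K M v" and image: "\<phi> ` carrier S = nonneg_part K M v"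
    and xy: "x \<in> carrier S" "y \<in> carrier S"
  shows "(\<exists>s\<in>carrier S. x = s \<otimes>\<^bsub>S\<^esub> y) \<or> (\<exists>t\<in>carrier S. y = t \<otimes>\<^bsub>S\<^esub> x)"
proof -
  interpret S: csemiring S by fact
  interpret K: semifield K by fact
  have hom: "\<phi> \<in> ring_hom S K" and inj: "inj_on \<phi> (carrier S)"
    and zero: "\<phi> \<zero>\<^bsub>S\<^esub> = \<zero>\<^bsub>K\<^esub>"
    using \<phi> unfolding semiring_embedding_def by blast+
  note closed = ring_hom_closed[OF hom]
  have nonzero: "\<phi> z \<noteq> \<zero>\<^bsub>K\<^esub>" if "z \<in> carrier S" "z \<noteq> \<zero>\<^bsub>S\<^esub>" for z
    using inj that zero by (metis inj_on_eq_iff S.zero_closed)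
  have multiple: "\<exists>s\<in>carrier S. a = s \<otimes>\<^bsub>S\<^esub> b"
    if ab: "a \<in> carrier S" "b \<in> carrier S" "k \<in> nonneg_part K M v" "\<phi> a = k \<otimes>\<^bsub>K\<^esub> \<phi> b" for a b k
  proof -
    obtain s where s: "s \<in> carrier S" "k = \<phi> s" using image ab(3) by blast
    then have "\<phi> a = \<phi> (s \<otimes>\<^bsub>S\<^esub> b)" using ab ring_hom_mult[OF hom] by simp
    then have "a = s \<otimes>\<^bsub>S\<^esub> b" using inj ab s by (simp add: inj_on_eq_iff)
    with s show ?thesis by blast
  qed
  show ?thesis
  proof (cases "x = \<zero>\<^bsub>S\<^esub> \<or> y = \<zero>\<^bsub>S\<^esub>")
    case True
    then show ?thesis using xy by (metis S.l_null S.zero_closed)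
  next
    case False
    obtain x' where x': "x' \<in> carrier K" "\<phi> x \<otimes>\<^bsub>K\<^esub> x' = \<one>\<^bsub>K\<^esub>"
      using K.nonzero_inverse[OF closed[OF xy(1)]] nonzero xy False by blast
    obtain y' where y': "y' \<in> carrier K" "\<phi> y \<otimes>\<^bsub>K\<^esub> y' = \<one>\<^bsub>K\<^esub>"
      using K.nonzero_inverse[OF closed[OF xy(2)]] nonzero xy False by blast
    let ?k = "\<phi> x \<otimes>\<^bsub>K\<^esub> y'" and ?l = "\<phi> y \<otimes>\<^bsub>K\<^esub> x'"
    have kl_closed: "?k \<in> carrier K" "?l \<in> carrier K"
      using x'(1) y'(1) closed xy by simp_all
    have "?k \<otimes>\<^bsub>K\<^esub> \<phi> y = \<phi> x \<otimes>\<^bsub>K\<^esub> (\<phi> y \<otimes>\<^bsub>K\<^esub> y')"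
      using y'(1) closed xy by (simp add: K.m_ac)
    then have x_eq: "\<phi> x = ?k \<otimes>\<^bsub>K\<^esub> \<phi> y"
      using closed[OF xy(1)] by (simp add: y'(2))
    have "?l \<otimes>\<^bsub>K\<^esub> \<phi> x = \<phi> y \<otimes>\<^bsub>K\<^esub> (\<phi> x \<otimes>\<^bsub>K\<^esub> x')"
      using x'(1) closed xy by (simp add: K.m_ac)
    then have y_eq: "\<phi> y = ?l \<otimes>\<^bsub>K\<^esub> \<phi> x"
      using closed[OF xy(2)] by (simp add: x'(2))
    have "?k \<otimes>\<^bsub>K\<^esub> ?l = (\<phi> x \<otimes>\<^bsub>K\<^esub> x') \<otimes>\<^bsub>K\<^esub> (\<phi> y \<otimes>\<^bsub>K\<^esub> y')"
      using x'(1) y'(1) closed xy by (simp add: K.m_ac)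
    then have "?k \<otimes>\<^bsub>K\<^esub> ?l = \<one>\<^bsub>K\<^esub>"
      by (simp add: x'(2) y'(2))
    then have "?k \<in> nonneg_part K M v \<or> ?l \<in> nonneg_part K M v"
      by (rule valuation_inverse_nonneg[OF v kl_closed])
    then show ?thesis
      using multiple[OF xy _ x_eq] multiple[OF xy(2,1) _ y_eq] by blast
  qed
qed

theorem proposition3p7:
  fixes S :: "'a ring" and J :: "'a set"
  assumes "valuation_semiring TYPE('k) TYPE('m) S"
    and "maximal_semiring_ideal S J"
    and "subtractive S J"
  shows "integrally_closed S"
proof -
  obtain K :: "'k ring" and \<phi> :: "'a \<Rightarrow> 'k" and M :: "'m tomonoid" and v :: "'k \<Rightarrow> 'm option"
    where S: "csemiring S" and K: "semifield K" and \<phi>: "semiring_embedding S K \<phi>"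
      and v: "valuation K M v" and image: "\<phi> ` carrier S = nonneg_part K M v"
    using assms(1) unfolding valuation_semiring_def by blast
  interpret S: cancellative_csemiring S
    using S semiring_embedding_mult_cancellative[OF S semifield.mult_cancellative[OF K] \<phi>]
    by (intro cancellative_csemiring.intro cancellative_csemiring_axioms.intro)
  show ?thesis
    using valuation_semiring_divides_total[OF S K \<phi> v image] assms(2,3)
    by (rule S.integrally_closed_if_divides_total)
qed

end
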